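(* For every continuous function $f:[0,1]\to\mathbb{R}$, every sequence $\mathbf{x}=\{x_n\}_{n=1}^\infty\subset[0,1]$ and every $N\in\mathbb{N}$ there holds $$\mathcal{E}_N(f;\mathbf{x})\le D_N^*(\mathbf{x})\,\nu(f;2N+2).$$
   Context: Here $\mathbb{N}=\{1,2,3,\dots\}$. For a sequence $\mathbf{x}=\{x_n\}_{n=1}^\infty\subset[0,1]$ and $f:[0,1]\to\mathbb{R}$, the quadrature error is $$\mathcal{E}_N(f;\mathbf{x})=\left|\frac1N\sum_{n=1}^N f(x_n)-\int_0^1 f(t)\,dt\right|.$$ For $E\subset[0,1]$ let $A_N(E,\mathbf{x})=\sum_{n=1}^N\chi_E(x_n)$, where $\chi_E$ is the indicator function of $E$ (the number of indices $1\le n\le N$ with $x_n\in E$). The star discrepancy is $$D_N^*(\mathbf{x})=\sup_{0<b\le1}\left|\frac{A_N([0,b),\mathbf{x})}{N}-b\right|.$$ For an interval $I=[a,b]\subset[0,1]$ write $f(I)=f(b)-f(a)$. For $k\in\mathbb{N}$, the modulus of variation of $f$ is $$\nu(f;k)=\sup\sum_j|f(I_j)|,$$ where the supremum is taken over all collections of at most $k$ non-overlapping subintervals $I_j$ of $[0,1]$ (non-overlapping: disjoint interiors). *)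

theory Defs
  imports "HOL-Analysis.Analysis"
begin

(* Sequences are functions on nat of which only the values at indices n >= 1 are used. *)

definition quad_error :: "nat \<Rightarrow> (real \<Rightarrow> real) \<Rightarrow> (nat \<Rightarrow> real) \<Rightarrow> real" where
  "quad_error N f x = \<bar>(1 / real N) * (\<Sum>n=1..N. f (x n)) - integral {0..1} f\<bar>"

definition count_in :: "nat \<Rightarrow> real set \<Rightarrow> (nat \<Rightarrow> real) \<Rightarrow> real" where
  "count_in N E x = (\<Sum>n=1..N. indicator E (x n))"

definition star_discrepancy :: "nat \<Rightarrow> (nat \<Rightarrow> real) \<Rightarrow> real" where
  "star_discrepancy N x = (SUP b\<in>{0<..1}. \<bar>count_in N {0..<b} x / real N - b\<bar>)"

(* A pair (a, b) stands for the interval [a, b].  Degenerate intervals are left out: they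
   contribute nothing to the sums below. *)
definition nonoverlapping :: "(real \<times> real) set \<Rightarrow> bool" where
  "nonoverlapping P \<longleftrightarrow>
     (\<forall>(a, b)\<in>P. 0 \<le> a \<and> a < b \<and> b \<le> 1) \<and>
     disjoint_family_on (\<lambda>(a, b). interior {a..b}) P"

(* The supremum is taken in the reals, so it is meaningful for functions f bounded on [0,1],
   in particular for continuous ones; see bdd_above_modulus_of_variation. *)
definition modulus_of_variation :: "(real \<Rightarrow> real) \<Rightarrow> nat \<Rightarrow> real" where
  "modulus_of_variation f k =
     (SUP P\<in>{P. finite P \<and> card P \<le> k \<and> nonoverlapping P}. \<Sum>(a, b)\<in>P. \<bar>f b - f a\<bar>)"

lemma bdd_above_star_discrepancy:
  "bdd_above ((\<lambda>b. \<bar>count_in N {0..<b} x / real N - b\<bar>) ` {0<..1})"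
proof (rule bdd_aboveI2)
  fix b :: real assume b: "b \<in> {0<..1}"
  have "count_in N {0..<b} x \<le> (\<Sum>n=1..N. 1)"
    unfolding count_in_def by (intro sum_mono) (simp add: indicator_def)
  then have "count_in N {0..<b} x / real N \<le> 1"
    by (cases "N = 0") (simp_all add: divide_le_eq)
  moreover have "0 \<le> count_in N {0..<b} x / real N"
    unfolding count_in_def by (intro divide_nonneg_nonneg sum_nonneg) simp_all
  ultimately show "\<bar>count_in N {0..<b} x / real N - b\<bar> \<le> 1"
    using b by auto
qed

lemma bdd_above_modulus_of_variation:
  fixes f :: "real \<Rightarrow> real"
  assumes "continuous_on {0..1} f"
  shows "bdd_above ((\<lambda>P. \<Sum>(a, b)\<in>P. \<bar>f b - f a\<bar>) `
           {P. finite P \<and> card P \<le> k \<and> nonoverlapping P})"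
proof -
  have "bounded (f ` {0..1})"
    using assms compact_continuous_image compact_imp_bounded by blast
  then obtain B where B: "\<And>t. t \<in> {0..1} \<Longrightarrow> \<bar>f t\<bar> \<le> B"
    unfolding bounded_iff by (metis image_eqI real_norm_def)
  have "0 \<le> B" using B[of 0] by simp
  show ?thesis
  proof (rule bdd_aboveI2)
    fix P assume P: "P \<in> {P. finite P \<and> card P \<le> k \<and> nonoverlapping P}"
    have "(\<Sum>(a, b)\<in>P. \<bar>f b - f a\<bar>) \<le> real (card P) * (2 * B)"
    proof (rule sum_bounded_above)
      fix p assume p: "p \<in> P"
      obtain a b where ab: "p = (a, b)" by (cases p)
      then have "0 \<le> a" "a < b" "b \<le> 1" using P p by (auto simp: nonoverlapping_def)
      then show "(case p of (a, b) \<Rightarrow> \<bar>f b - f a\<bar>) \<le> 2 * B"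
        using B[of a] B[of b] ab by auto
    qed
    also have "\<dots> \<le> real k * (2 * B)"
      using P \<open>0 \<le> B\<close> by (intro mult_right_mono) auto
    finally show "(\<Sum>(a, b)\<in>P. \<bar>f b - f a\<bar>) \<le> real k * (2 * B)" .
  qed
qed

end

theory Submission
  imports Defs
begin

text \<open>Sort the points as \<open>y\<^sub>1 \<le> \<dots> \<le> y\<^sub>N\<close> and put \<open>y\<^sub>0 = 0\<close>, \<open>y\<^sub>N\<^sub>+\<^sub>1 = 1\<close>. By the mean value
  theorem the integral over \<open>[y\<^sub>i, y\<^sub>i\<^sub>+\<^sub>1]\<close> is \<open>(y\<^sub>i\<^sub>+\<^sub>1 - y\<^sub>i) f(c\<^sub>i)\<close> with \<open>c\<^sub>i\<close> in that interval, so the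
  error is a combination of the values of \<open>f\<close> at \<open>c\<^sub>0 \<le> y\<^sub>1 \<le> c\<^sub>1 \<le> \<dots> \<le> y\<^sub>N \<le> c\<^sub>N\<close> with total weight zero.
  Summation by parts turns it into a combination of the \<open>2N\<close> increments of \<open>f\<close> between these points,
  with coefficients \<open>i/N - y\<^sub>i\<close> and \<open>i/N - y\<^sub>i\<^sub>+\<^sub>1\<close>, which are bounded by the star discrepancy.\<close>

text \<open>The mean value theorem for the antiderivative of \<open>f\<close>. The case
  \<open>a = b\<close> is included because consecutive points may coincide.\<close>

lemma integral_mean_value:
  fixes f :: "real \<Rightarrow> real"
  assumes "a \<le> b" "continuous_on {a..b} f"
  obtains c where "a \<le> c" "c \<le> b" "integral {a..b} f = (b - a) * f c"
proof -
  have "\<exists>c\<in>{a..b}. integral {a..b} f - integral {a..a} f = (\<lambda>h. h *\<^sub>R f c) (b - a)"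
    using assms integral_has_vector_derivative[OF assms(2)]
    by (intro mvt_very_simple) (auto simp: has_vector_derivative_def)
  then show thesis using that by auto
qed

text \<open>Quadrature sum and counting function depend on the points only through sums of this
  form, so the third property lets sorted points replace the given ones without changing
  either.\<close>

lemma sorted_rearrangement:
  fixes x :: "nat \<Rightarrow> 'a::linorder"
  obtains y :: "nat \<Rightarrow> 'a"
  where "mono_on {1..N} y" "y ` {1..N} = x ` {1..N}"
    "\<And>g :: 'a \<Rightarrow> 'b::comm_monoid_add. (\<Sum>n=1..N. g (y n)) = (\<Sum>n=1..N. g (x n))"
proof -
  define ys where "ys = sort (map x [1..<Suc N])"
  have len: "length ys = N" by (simp add: ys_def)
  define y where "y n = ys ! (n - 1)" for n
  have "mono_on {1..N} y"
    using sorted_nth_mono[of ys] len by (auto simp: y_def ys_def intro!: mono_onI)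
  moreover have "y ` {1..N} = x ` {1..N}"
  proof -
    have "y ` {1..N} = (!) ys ` ((\<lambda>n. n - 1) ` {1..N})"
      by (simp add: image_image y_def)
    also have "(\<lambda>n. n - 1) ` {1..N} = {..<N}"
      by (force simp: image_iff intro: bexI[of _ "Suc _"])
    also have "(!) ys ` {..<N} = set ys" by (auto simp: set_conv_nth len)
    also have "\<dots> = x ` {1..N}" by (auto simp: ys_def)
    finally show ?thesis .
  qed
  moreover have "(\<Sum>n=1..N. g (y n)) = (\<Sum>n=1..N. g (x n))" for g :: "'a \<Rightarrow> 'b"
  proof -
    have "(\<Sum>n=1..N. g (y n)) = (\<Sum>i<N. g (ys ! i))"
      by (simp add: y_def sum.atLeast1_atMost_eq)
    also have "\<dots> = sum_list (map g ys)"
      by (simp add: sum_list_sum_nth len atLeast0LessThan)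
    also have "\<dots> = sum_list (map g (map x [1..<Suc N]))"
      \<comment> \<open>The sum of a list depends only on its multiset of entries, which sorting
        preserves.\<close>
      by (simp only: ys_def sum_mset_sum_list[symmetric] mset_map mset_sort)
    also have "\<dots> = (\<Sum>n=1..N. g (x n))"
      by (simp add: interv_sum_list_conv_sum_set_nat o_def atLeastLessThanSuc_atLeastAtMost del: upt_Suc)
    finally show ?thesis .
  qed
  ultimately show thesis using that by blast
qed

lemma sum_increments_le_modulus_of_variation:
  fixes f :: "real \<Rightarrow> real" and z :: "nat \<Rightarrow> real"
  assumes f: "continuous_on {0..1} f" and "m \<le> k"
    and mono: "mono_on {..m} z" and z: "z ` {..m} \<subseteq> {0..1}"
  shows "(\<Sum>j<m. \<bar>f (z (Suc j)) - f (z j)\<bar>) \<le> modulus_of_variation f k"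
proof -
  have le: "z i \<le> z j" if "i \<le> j" "j \<le> m" for i j
    using mono that by (auto simp: mono_on_def)
  define J where "J = {j. j < m \<and> z j < z (Suc j)}"
  define h where "h j = (z j, z (Suc j))" for j
  define P where "P = h ` J"
  have fin: "finite J" by (simp add: J_def)
  have sep: "z (Suc i) \<le> z j" if "i < j" "j \<in> J" for i j
    using that le[of "Suc i" j] by (auto simp: J_def)
  \<comment> \<open>With degenerate intervals discarded, distinct indices give distinct pairs, so
    the sum over the set \<open>P\<close> counts every increment once.\<close>
  have inj: "inj_on h J"
  proof (rule linorder_inj_onI')
    fix i j assume "i \<in> J" "j \<in> J" "i < j"
    then show "h i \<noteq> h j" using sep[of i j] by (auto simp: h_def J_def)
  qed
  have disj: "{z i<..<z (Suc i)} \<inter> {z j<..<z (Suc j)} = {}" if "i \<in> J" "j \<in> J" "i \<noteq> j" for i j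
    using that
  proof (induction i j rule: linorder_wlog)
    case (le i j)
    then show ?case using sep[of i j] by auto
  qed auto
  have "nonoverlapping P"
    unfolding nonoverlapping_def
  proof
    show "\<forall>(a, b)\<in>P. 0 \<le> a \<and> a < b \<and> b \<le> 1"
      using z by (auto simp: P_def h_def J_def image_subset_iff)
    show "disjoint_family_on (\<lambda>(a, b). interior {a..b}) P"
      unfolding disjoint_family_on_def P_def
      using disj by (fastforce simp: h_def)
  qed
  moreover have "card P \<le> k"
  proof -
    have "card P \<le> card J" unfolding P_def by (rule card_image_le[OF fin])
    also have "\<dots> \<le> card {..<m}" by (rule card_mono) (auto simp: J_def)
    finally show ?thesis using \<open>m \<le> k\<close> by simp
  qed
  ultimately have P: "P \<in> {P. finite P \<and> card P \<le> k \<and> nonoverlapping P}"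
    using fin by (simp add: P_def)
  have "(\<Sum>j<m. \<bar>f (z (Suc j)) - f (z j)\<bar>) = (\<Sum>j\<in>J. \<bar>f (z (Suc j)) - f (z j)\<bar>)"
    \<comment> \<open>Off \<open>J\<close>, monotonicity forces \<open>z j = z (Suc j)\<close>, and
      the increment vanishes.\<close>
    using le[of _ "Suc _"]
    by (intro sum.mono_neutral_right) (force simp: J_def less_le)+
  also have "\<dots> = (\<Sum>(a, b)\<in>P. \<bar>f b - f a\<bar>)"
    unfolding P_def sum.reindex[OF inj] by (simp add: h_def)
  also have "\<dots> \<le> modulus_of_variation f k"
    unfolding modulus_of_variation_def
    by (rule cSUP_upper[OF P bdd_above_modulus_of_variation[OF f]])
  finally show ?thesis .
qed

lemma star_discrepancy_upper:
  assumes "0 < b" "b \<le> 1"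
  shows "\<bar>count_in N {0..<b} x / real N - b\<bar> \<le> star_discrepancy N x"
  unfolding star_discrepancy_def
  by (rule cSUP_upper) (use assms in \<open>auto intro: bdd_above_star_discrepancy\<close>)

lemma star_discrepancy_nonneg: "0 \<le> star_discrepancy N x"
  using star_discrepancy_upper[of 1 N x] by linarith

text \<open>At most \<open>i - 1\<close> points lie strictly below \<open>x i\<close>, so
  \<open>b = x i\<close> gives the first bound. For \<open>b\<close> beyond \<open>x i\<close> at
  least \<open>i\<close> points lie in \<open>{0..<b}\<close>; letting \<open>b\<close> decrease to
  \<open>x i\<close> gives the second.\<close>

lemma star_discrepancy_sorted:
  fixes x :: "nat \<Rightarrow> real"
  assumes mono: "mono_on {1..N} x" and x: "x ` {1..N} \<subseteq> {0..1}" and i: "1 \<le> i" "i \<le> N"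
  shows "x i - (real i - 1) / real N \<le> star_discrepancy N x"
    and "real i / real N - x i \<le> star_discrepancy N x"
proof -
  let ?D = "star_discrepancy N x"
  have xi: "0 \<le> x i" "x i \<le> 1" using x i by (auto simp: image_subset_iff)
  have le: "x j \<le> x k" if "1 \<le> j" "j \<le> k" "k \<le> N" for j k
    using mono that by (auto simp: mono_on_def)
  show "x i - (real i - 1) / real N \<le> ?D"
  \<comment> \<open>The supremum runs over positive \<open>b\<close> only; for
    \<open>x i = 0\<close> the left side is at most zero.\<close>
  proof (cases "x i = 0")
    case True
    have "0 \<le> (real i - 1) / real N" using i by simp
    then show ?thesis using True star_discrepancy_nonneg[of N x] by linarith
  next
    case False
    have "count_in N {0..<x i} x \<le> (\<Sum>n=1..N. if n < i then 1 else 0)"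
      unfolding count_in_def using i le[of i]
      by (intro sum_mono) (auto simp: indicator_def not_less[symmetric])
    also have "\<dots> = (\<Sum>n\<in>{1..<i}. 1)"
      using i by (intro sum.mono_neutral_cong_right) auto
    also have "\<dots> = real i - 1" using i by (simp add: of_nat_diff)
    finally have "count_in N {0..<x i} x / real N \<le> (real i - 1) / real N"
      by (simp add: divide_right_mono)
    then show ?thesis using star_discrepancy_upper[of "x i" N x] xi False by linarith
  qed
  show "real i / real N - x i \<le> ?D"
  \<comment> \<open>For \<open>x i = 1\<close> no admissible \<open>b\<close> exceeds
    \<open>x i\<close>, but again the left side is at most zero.\<close>
  proof (cases "x i = 1")
    case True
    have "real i / real N \<le> 1" using i by (simp add: divide_le_eq)
    then show ?thesis using True star_discrepancy_nonneg[of N x] by linarith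
  next
    case False
    have "real i / real N - ?D \<le> b" if b: "x i < b" "b < 1" for b
    proof -
      have "real i = (\<Sum>n\<in>{1..i}. 1)" by simp
      also have "\<dots> = (\<Sum>n=1..N. if n \<le> i then 1 else 0)"
        using i by (intro sum.mono_neutral_cong_left) auto
      also have "\<dots> \<le> count_in N {0..<b} x"
        unfolding count_in_def
      proof (rule sum_mono)
        fix n assume "n \<in> {1..N}"
        then show "(if n \<le> i then 1 else 0) \<le> (indicator {0..<b} (x n) :: real)"
          using le[of n i] i b x by (auto simp: indicator_def image_subset_iff)
      qed
      finally have "real i / real N \<le> count_in N {0..<b} x / real N"
        by (simp add: divide_right_mono)
      then show ?thesis using star_discrepancy_upper[of b N x] b xi by linarith
    qed
    then have "real i / real N - ?D \<le> x i"
      using False xi by (intro dense_ge_bounded[of "x i" 1]) auto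
    then show ?thesis by linarith
  qed
qed

text \<open>Abel summation along u 0, v 1, u 1, v 2, ..., u k: each difference is multiplied by the
  sum of the weights met so far, \<open>q\<close> for every v and minus the mesh length for every u;
  the lengths telescope.\<close>

lemma summation_by_parts_interlaced:
  fixes y u v w :: "nat \<Rightarrow> real"
  assumes "y 0 = 0"
  shows "(\<Sum>i<k. q * v (Suc i)) - (\<Sum>i<k. (y (Suc i) - y i) * u i) =
    (\<Sum>i<k. (q * real i - y (Suc i)) * (u i - v (Suc i)) +
            (q * real (Suc i) - y (Suc i)) * (v (Suc i) - u (Suc i)))
    + (q * real k - y k) * u k"
  by (induction k) (simp_all add: assms algebra_simps)

theorem theorem1p2:
  fixes f :: "real \<Rightarrow> real" and x :: "nat \<Rightarrow> real" and N :: nat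
  assumes "continuous_on {0..1} f"
    and "\<And>n. n \<ge> 1 \<Longrightarrow> x n \<in> {0..1}"
    and "N \<ge> 1"
  shows "quad_error N f x \<le> star_discrepancy N x * modulus_of_variation f (2 * N + 2)"
proof -
  obtain s where s: "mono_on {1..N} s" "s ` {1..N} = x ` {1..N}"
    and sums: "\<And>g :: real \<Rightarrow> real. (\<Sum>n=1..N. g (s n)) = (\<Sum>n=1..N. g (x n))"
    using sorted_rearrangement[of N x] by blast
  let ?D = "star_discrepancy N x"
  have D: "star_discrepancy N s = ?D"
    unfolding star_discrepancy_def count_in_def sums ..
  have s01: "s ` {1..N} \<subseteq> {0..1}" using assms(2) s(2) by auto
  \<comment> \<open>The constant value 1 beyond \<open>N\<close> keeps \<open>y\<close> monotone and
    in the unit interval at all indices, so \<open>c\<close> below can be chosen for every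
    \<open>i\<close>.\<close>
  define y where "y i = (if i = 0 then 0 else if i \<le> N then s i else 1)" for i
  have y_s: "y i = s i" if "1 \<le> i" "i \<le> N" for i using that by (simp add: y_def)
  have y0: "y 0 = 0" and y1: "y (Suc N) = 1" by (simp_all add: y_def)
  have y01: "y i \<in> {0..1}" for i
    using s01 by (auto simp: y_def image_subset_iff)
  have y_le: "y i \<le> y j" if "i \<le> j" for i j
    using s(1) y01[of i] y01[of j] that by (auto simp: y_def mono_on_def)
  have cont: "continuous_on {a..b} f" if "0 \<le> a" "b \<le> 1" for a b
    by (rule continuous_on_subset[OF assms(1)]) (use that in auto)
  have "\<exists>c. y i \<le> c \<and> c \<le> y (Suc i) \<and> integral {y i..y (Suc i)} f = (y (Suc i) - y i) * f c" for i
    using integral_mean_value[of "y i" "y (Suc i)" f] y_le[of i "Suc i"] y01[of i] y01[of "Suc i"] cont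
    by (metis atLeastAtMost_iff le_SucI order_refl)
  then obtain c where c: "\<And>i. y i \<le> c i" "\<And>i. c i \<le> y (Suc i)"
    and int_c: "\<And>i. integral {y i..y (Suc i)} f = (y (Suc i) - y i) * f (c i)"
    by metis
  have int_y: "integral {0..y k} f = (\<Sum>i<k. (y (Suc i) - y i) * f (c i))" for k
  proof (induction k)
    case 0
    then show ?case by (simp add: y0)
  next
    case (Suc k)
    have "integral {0..y k} f + integral {y k..y (Suc k)} f = integral {0..y (Suc k)} f"
      using y01[of k] y01[of "Suc k"] y_le[of k "Suc k"]
      by (intro Henstock_Kurzweil_Integration.integral_combine integrable_continuous_real cont) auto
    then show ?case using Suc int_c[of k] by simp
  qed
  let ?T = "\<lambda>i. (1 / N * real i - y (Suc i)) * (f (c i) - f (y (Suc i))) +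
     (1 / N * real (Suc i) - y (Suc i)) * (f (y (Suc i)) - f (c (Suc i)))"
  let ?V = "\<lambda>i. \<bar>f (y (Suc i)) - f (c i)\<bar> + \<bar>f (c (Suc i)) - f (y (Suc i))\<bar>"
  have "(1 / real N) * (\<Sum>n=1..N. f (x n)) - integral {0..1} f
      = (\<Sum>i<N. 1 / N * f (y (Suc i))) - (\<Sum>i<N. (y (Suc i) - y i) * f (c i)) - (1 - y N) * f (c N)"
  proof -
    have "(\<Sum>n=1..N. f (x n)) = (\<Sum>i<N. f (y (Suc i)))"
      unfolding sums[symmetric] by (simp add: sum.atLeast1_atMost_eq y_s)
    moreover have "integral {0..1} f = (\<Sum>i<N. (y (Suc i) - y i) * f (c i)) + (1 - y N) * f (c N)"
      using int_y[of "Suc N"] by (simp add: y1)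
    ultimately show ?thesis by (simp add: sum_distrib_left)
  qed
  \<comment> \<open>For \<open>q = 1 / N\<close> the boundary term is
    \<open>(1 - y N) * f (c N)\<close>, which cancels the contribution of the last mesh
    interval.\<close>
  also have "\<dots> = (\<Sum>i<N. ?T i)"
    using summation_by_parts_interlaced[where y = y and k = N and q = "1 / N"
        and u = "\<lambda>i. f (c i)" and v = "\<lambda>i. f (y i)"] y0 assms(3)
    by simp
  finally have "quad_error N f x = \<bar>\<Sum>i<N. ?T i\<bar>"
    by (simp add: quad_error_def)
  also have "\<dots> \<le> (\<Sum>i<N. ?D * ?V i)"
  proof (rule order_trans[OF sum_abs], rule sum_mono)
    fix i assume "i \<in> {..<N}"
    then have "y (Suc i) - real i / N \<le> ?D" "real (Suc i) / N - y (Suc i) \<le> ?D"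
      using star_discrepancy_sorted[OF s(1) s01, of "Suc i"] by (simp_all add: D y_s)
    \<comment> \<open>The first coefficient is at least \<open>- ?D\<close> and the second at most
      \<open>?D\<close>; as the first does not exceed the second, both lie between these
      bounds.\<close>
    moreover have "real i / N \<le> real (Suc i) / N" by (simp add: divide_right_mono)
    ultimately have "\<bar>1 / N * real i - y (Suc i)\<bar> \<le> ?D" "\<bar>1 / N * real (Suc i) - y (Suc i)\<bar> \<le> ?D"
      unfolding abs_le_iff by simp_all
    then show "\<bar>?T i\<bar> \<le> ?D * ?V i"
      by (subst distrib_left, intro order_trans[OF abs_triangle_ineq] add_mono; subst abs_mult)
        (auto simp del: of_nat_Suc intro!: mult_mono)
  qed
  also have "\<dots> = ?D * (\<Sum>i<N. ?V i)" by (simp add: sum_distrib_left)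
  also have "\<dots> \<le> ?D * modulus_of_variation f (2 * N + 2)"
  proof (rule mult_left_mono[OF _ star_discrepancy_nonneg])
    \<comment> \<open>The interlaced chain c 0, y 1, c 1, y 2, ...; its increments 2i and 2i + 1
      make up \<open>?V i\<close>.\<close>
    define z where "z j = (if even j then c (j div 2) else y (Suc (j div 2)))" for j
    have "z j \<le> z (Suc j)" for j
      using c by (auto simp: z_def elim!: evenE oddE)
    then have "mono z" by (simp add: mono_iff_le_Suc)
    moreover have "z j \<in> {0..1}" for j
      using c[of "j div 2"] y01[of "j div 2"] y01[of "Suc (j div 2)"] by (auto simp: z_def)
    moreover have "(\<Sum>j<2 * k. \<bar>f (z (Suc j)) - f (z j)\<bar>) = (\<Sum>i<k. ?V i)" for k
      by (induction k) (simp_all add: z_def)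
    ultimately show "(\<Sum>i<N. ?V i) \<le> modulus_of_variation f (2 * N + 2)"
      using sum_increments_le_modulus_of_variation[OF assms(1), of "2 * N" "2 * N + 2" z]
      by (auto simp: mono_on_def mono_def image_subset_iff)
  qed
  finally show ?thesis .
qed

end
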